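(* Let $\varepsilon\in(0,1)$ and $c_\varepsilon>0$, and consider the deterministic three point vortex system in the plane $$\frac{\mathrm{d}x_i(t)}{\mathrm{d}t}=\sum_{j=1,\,j\neq i}^3\xi_jK_\varepsilon(x_i(t)-x_j(t)),\quad i=1,2,3,\qquad K_\varepsilon(x)=c_\varepsilon\frac{x^\perp}{|x|^{3-\varepsilon}},\ x\in\mathbb{R}^2\setminus\{0\},$$ with intensities $\xi_1,\xi_2,\xi_3\in\mathbb{R}\setminus\{0\}$ and pairwise distinct initial positions $x_1(0),x_2(0),x_3(0)\in\mathbb{R}^2$. Let $l_{i,j}(t)=|x_i(t)-x_j(t)|$. (a) Suppose that $S=0$ and $S_\varepsilon=0$, where $$S=\frac{l_{1,2}(0)^2}{\xi_3}+\frac{l_{2,3}(0)^2}{\xi_1}+\frac{l_{3,1}(0)^2}{\xi_2},\qquad S_\varepsilon=\frac{l_{1,2}(0)^{-1+\varepsilon}}{\xi_3}+\frac{l_{2,3}(0)^{-1+\varepsilon}}{\xi_1}+\frac{l_{3,1}(0)^{-1+\varepsilon}}{\xi_2},$$ and that $c_{i,j}<0$ for some $i\ne j$, where, with $k$ the remaining index ($\{i,j,k\}=\{1,2,3\}$), $$c_{i,j}=c_\varepsilon\,\xi_k\,l_{i,k}(0)\,l_{k,j}(0)\,l_{i,j}(0)^{1-\varepsilon}\sin(\varphi_{i,j})\left(\frac1{l_{i,k}(0)^{3-\varepsilon}}-\frac1{l_{k,j}(0)^{3-\varepsilon}}\right).$$ Then the three vortices collapse in finite time. (b) In particular, let $\varepsilon=1/2$,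 $x_1(0)=(-1,0)$, $x_2(0)=(1,0)$, $x_3(0)=(1,\sqrt2)$, $\xi_2=1$, and let $(\xi_1,\xi_3)$ be the solution of $$\frac4{\xi_3}+\frac2{\xi_1}+6=0,\qquad \frac{2^{-1/2}}{\xi_3}+\frac{2^{-1/4}}{\xi_1}+6^{-1/4}=0$$ (so $\xi_1\approx1.155616$, $\xi_3\approx-0.517419$). Then the three vortices collapse in finite time.
   Context: For $x=(x_1,x_2)\in\mathbb{R}^2$, $x^\perp=(-x_2,x_1)$ is the counter-clockwise rotation by $\pi/2$. $\varphi_{i,j}$ denotes the oriented angle at the initial time from the vector $x_j(0)-x_k(0)$ to the vector $x_i(0)-x_k(0)$, so that $\sin(\varphi_{i,j})>0$ exactly when $x_j(0),x_i(0),x_k(0)$ are the vertices of a nondegenerate triangle listed in counter-clockwise order, and $\sin(\varphi_{i,j})<0$ when this order is clockwise. The three vortices collapse in finite time if there is $T^*\in(0,\infty)$ such that the solution exists with $x_1(t),x_2(t),x_3(t)$ pairwise distinct for $t\in[0,T^* )$ and $l_{1,2}(t),l_{2,3}(t),l_{3,1}(t)\to0$ as $t\uparrow T^*$. *)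

theory Defs
  imports "HOL-Analysis.Analysis"
begin

definition perp :: "real^2 \<Rightarrow> real^2" where
  "perp x = vector [- x $ 2, x $ 1]"

text \<open>The value at 0 is an artefact of division by zero; the kernel is only ever used at
  differences of distinct points.\<close>

definition K_eps :: "real \<Rightarrow> real \<Rightarrow> real^2 \<Rightarrow> real^2" where
  "K_eps \<epsilon> c x = (c / norm x powr (3 - \<epsilon>)) *\<^sub>R perp x"

text \<open>The angle in the interval from \<open>-\<pi>\<close> (excluded) to \<open>\<pi>\<close> from \<open>u\<close> to \<open>v\<close>, positive in the
  counter-clockwise direction. For nonzero vectors it is characterised by
  \<open>oriented_angle_rotates\<close> below.\<close>

definition oriented_angle :: "real^2 \<Rightarrow> real^2 \<Rightarrow> real" where
  "oriented_angle u v = Arg (Complex (u \<bullet> v) (perp u \<bullet> v))"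

lemma norm_Complex_inner_perp: "cmod (Complex (u \<bullet> v) (perp u \<bullet> v)) = norm u * norm v"
proof -
  have "(u \<bullet> v)\<^sup>2 + (perp u \<bullet> v)\<^sup>2 = (u \<bullet> u) * (v \<bullet> v)"
    by (simp add: perp_def inner_vec_def sum_2 algebra_simps power2_eq_square)
  then show ?thesis
    by (simp add: complex_norm norm_eq_sqrt_inner[of u] norm_eq_sqrt_inner[of v] real_sqrt_mult)
qed

lemma cos_sin_oriented_angle:
  assumes "u \<noteq> 0" "v \<noteq> 0"
  shows "norm u * norm v * cos (oriented_angle u v) = u \<bullet> v"
    and "norm u * norm v * sin (oriented_angle u v) = perp u \<bullet> v"
proof -
  let ?z = "Complex (u \<bullet> v) (perp u \<bullet> v)"
  have "?z = of_real (cmod ?z) * exp (\<i> * of_real (Arg ?z))"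
    by (metis Arg_eq mult_zero_left norm_eq_zero of_real_0)
  then have "?z = of_real (norm u * norm v) * cis (oriented_angle u v)"
    by (simp add: norm_Complex_inner_perp oriented_angle_def cis_conv_exp)
  from arg_cong[OF this, of Re] arg_cong[OF this, of Im]
  show "norm u * norm v * cos (oriented_angle u v) = u \<bullet> v"
    and "norm u * norm v * sin (oriented_angle u v) = perp u \<bullet> v"
    by simp_all
qed

lemma oriented_angle_rotates:
  assumes "u \<noteq> 0" "v \<noteq> 0"
  shows "norm u *\<^sub>R v =
    norm v *\<^sub>R (cos (oriented_angle u v) *\<^sub>R u + sin (oriented_angle u v) *\<^sub>R perp u)"
proof -
  let ?r = "cos (oriented_angle u v) *\<^sub>R u + sin (oriented_angle u v) *\<^sub>R perp u"
  have "norm u *\<^sub>R (norm u *\<^sub>R v) = (u \<bullet> u) *\<^sub>R v"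
    by (simp add: dot_square_norm power2_eq_square)
  also have "\<dots> = (u \<bullet> v) *\<^sub>R u + (perp u \<bullet> v) *\<^sub>R perp u"
    by (simp add: vec_eq_iff forall_2 perp_def inner_vec_def sum_2 algebra_simps)
  also have "\<dots> = norm u *\<^sub>R (norm v *\<^sub>R ?r)"
    unfolding cos_sin_oriented_angle[OF assms, symmetric]
    by (simp add: scaleR_add_right mult.assoc)
  finally show ?thesis using assms(1) unfolding scaleR_cancel_left by simp
qed

lemma sin_oriented_angle_pos_iff:
  fixes u v :: "real^2"
  assumes "u \<noteq> 0" "v \<noteq> 0"
  shows "sin (oriented_angle u v) > 0 \<longleftrightarrow> u $ 1 * v $ 2 - u $ 2 * v $ 1 > 0"
proof -
  have "norm u * norm v * sin (oriented_angle u v) = u $ 1 * v $ 2 - u $ 2 * v $ 1"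
    using cos_sin_oriented_angle(2)[OF assms] by (simp add: perp_def inner_vec_def sum_2)
  moreover have "norm u * norm v > 0" using assms by simp
  ultimately show ?thesis by (metis zero_less_mult_pos mult_pos_pos)
qed

text \<open>Configurations of three points are indexed by the three-element type \<open>3\<close>, whose elements are
  \<open>1\<close>, \<open>2\<close> and \<open>3\<close>.\<close>

definition l :: "(real^2)^3 \<Rightarrow> 3 \<Rightarrow> 3 \<Rightarrow> real" where
  "l a i j = norm (a $ i - a $ j)"

definition S :: "real^3 \<Rightarrow> (real^2)^3 \<Rightarrow> real" where
  "S \<xi> a = (l a 1 2)\<^sup>2 / \<xi> $ 3 + (l a 2 3)\<^sup>2 / \<xi> $ 1 + (l a 3 1)\<^sup>2 / \<xi> $ 2"

definition S_eps :: "real \<Rightarrow> real^3 \<Rightarrow> (real^2)^3 \<Rightarrow> real" where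
  "S_eps \<epsilon> \<xi> a = l a 1 2 powr (- 1 + \<epsilon>) / \<xi> $ 3 + l a 2 3 powr (- 1 + \<epsilon>) / \<xi> $ 1
    + l a 3 1 powr (- 1 + \<epsilon>) / \<xi> $ 2"

text \<open>In \<open>angle a i j k\<close> and \<open>c_coeff \<epsilon> c \<xi> a i j k\<close> the index \<open>k\<close> is meant to be the one different
  from \<open>i\<close> and \<open>j\<close>.\<close>

definition angle :: "(real^2)^3 \<Rightarrow> 3 \<Rightarrow> 3 \<Rightarrow> 3 \<Rightarrow> real" where
  "angle a i j k = oriented_angle (a $ j - a $ k) (a $ i - a $ k)"

definition c_coeff :: "real \<Rightarrow> real \<Rightarrow> real^3 \<Rightarrow> (real^2)^3 \<Rightarrow> 3 \<Rightarrow> 3 \<Rightarrow> 3 \<Rightarrow> real" where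
  "c_coeff \<epsilon> c \<xi> a i j k =
    c * \<xi> $ k * l a i k * l a k j * l a i j powr (1 - \<epsilon>) * sin (angle a i j k) *
    (1 / l a i k powr (3 - \<epsilon>) - 1 / l a k j powr (3 - \<epsilon>))"

text \<open>The derivative at time 0 is one-sided.\<close>

definition vortex_solution ::
  "real \<Rightarrow> real \<Rightarrow> real^3 \<Rightarrow> (real^2)^3 \<Rightarrow> real \<Rightarrow> (real \<Rightarrow> (real^2)^3) \<Rightarrow> bool" where
  "vortex_solution \<epsilon> c \<xi> a T x \<longleftrightarrow>
    x 0 = a \<and>
    (\<forall>t\<in>{0..<T}. \<forall>i j. i \<noteq> j \<longrightarrow> x t $ i \<noteq> x t $ j) \<and>
    (\<forall>t\<in>{0..<T}. \<forall>i. ((\<lambda>s. x s $ i) has_vector_derivative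
      (\<Sum>j\<in>UNIV - {i}. \<xi> $ j *\<^sub>R K_eps \<epsilon> c (x t $ i - x t $ j))) (at t within {0..<T}))"

text \<open>Off collisions the vector field is locally Lipschitz, so there is at most one solution on
  \<open>{0..<T}\<close> with given initial positions and asserting its existence is unambiguous.\<close>

definition collapses :: "real \<Rightarrow> real \<Rightarrow> real^3 \<Rightarrow> (real^2)^3 \<Rightarrow> bool" where
  "collapses \<epsilon> c \<xi> a \<longleftrightarrow>
    (\<exists>T>0. \<exists>x. vortex_solution \<epsilon> c \<xi> a T x \<and>
      (\<forall>i j. i \<noteq> j \<longrightarrow> ((\<lambda>t. l (x t) i j) \<longlongrightarrow> 0) (at_left T)))"

end

theory Submission
  imports Defs
begin

text \<open>
  The collapse is self-similar and can be written down explicitly. Identify the plane with the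
  complex numbers and let \<open>V m\<close> be the initial velocity of the vortex at \<open>w m\<close>. Suppose that one
  complex number \<open>\<lambda>\<close> satisfies \<open>V m - V n = \<lambda> (w m - w n)\<close> for all \<open>m\<close>, \<open>n\<close>, with negative
  real part. Then there is a centre \<open>p\<close> with \<open>V m = \<lambda> (w m - p)\<close>. Since the kernel commutes with
  rotations and is homogeneous of degree \<open>\<epsilon> - 2\<close>, the curves \<open>p + z(t) (w m - p)\<close> solve the
  system as soon as \<open>z' = \<lambda> z / \<bar>z\<bar> powr (3 - \<epsilon>)\<close>, \<open>z(0) = 1\<close>. Along this equation
  \<open>\<bar>z\<bar> powr (3 - \<epsilon>)\<close> decreases at the constant rate \<open>(3 - \<epsilon>) Re \<lambda>\<close>, so it equals \<open>1 - t / T\<close>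
  with \<open>T = - 1 / ((3 - \<epsilon>) Re \<lambda>)\<close>, and everything contracts to \<open>p\<close> at time \<open>T\<close>
  (\<open>self_similar_collapse\<close>).

  It remains to find \<open>\<lambda>\<close> (\<open>collapse_of_triangle\<close>). The velocity differences across two sides
  \<open>u\<close>, \<open>v\<close> of the triangle are linear combinations of \<open>u\<close> and \<open>v\<close>, and the requirement
  that the two ratios agree is one complex equation. Its imaginary and real part are two linear
  relations between the squared side lengths and their products with the kernel strengths, and
  both are obtained by eliminating one side between \<open>S = 0\<close> and \<open>S_eps = 0\<close>
  (\<open>complex_ratio_identity\<close>). Finally, \<open>c_coeff\<close> is a positive multiple of \<open>Re \<lambda>\<close>.

  The explicit configuration satisfies the hypotheses by construction. Its intensities solve a
  linear system in \<open>1 / \<xi>1\<close> and \<open>1 / \<xi>3\<close>, and rational bounds on the roots involved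
  locate them (\<open>explicit_intensities\<close>).
\<close>

section \<open>The plane as the complex numbers\<close>

definition to_plane :: "complex \<Rightarrow> real^2" where
  "to_plane z = vector [Re z, Im z]"

lemma to_plane_of_components: "to_plane (Complex (p $ 1) (p $ 2)) = p"
  by (simp add: to_plane_def vec_eq_iff forall_2)

lemma bounded_linear_to_plane: "bounded_linear to_plane"
  unfolding linear_conv_bounded_linear[symmetric]
  by (intro linearI) (simp_all add: to_plane_def vec_eq_iff forall_2)

lemma to_plane_diff: "to_plane (z - w) = to_plane z - to_plane w"
  by (simp add: to_plane_def vec_eq_iff forall_2)

lemma to_plane_scaleR: "to_plane (r *\<^sub>R z) = r *\<^sub>R to_plane z"
  by (simp add: to_plane_def vec_eq_iff forall_2)

lemma norm_to_plane: "norm (to_plane z) = cmod z"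
  by (simp add: to_plane_def norm_vec_def L2_set_def sum_2 cmod_def)

lemma inj_to_plane: "to_plane z = to_plane w \<longleftrightarrow> z = w"
  by (auto simp: to_plane_def vec_eq_iff forall_2 complex_eq_iff)

lemma perp_to_plane: "perp (to_plane z) = to_plane (\<i> * z)"
  by (simp add: perp_def to_plane_def vec_eq_iff forall_2)

lemma perp_inner_to_plane: "perp (to_plane z) \<bullet> to_plane w = Im (cnj z * w)"
  by (simp add: perp_def to_plane_def inner_vec_def sum_2)

definition kern :: "real \<Rightarrow> real \<Rightarrow> complex \<Rightarrow> real" where
  "kern \<epsilon> c z = c / cmod z powr (3 - \<epsilon>)"

lemma kern_mult: "kern \<epsilon> c (z * w) = kern \<epsilon> c w / cmod z powr (3 - \<epsilon>)"
  by (simp add: kern_def norm_mult powr_mult)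

lemma kern_diff_commute: "kern \<epsilon> c (z - w) = kern \<epsilon> c (w - z)"
  by (simp add: kern_def norm_minus_commute)

lemma K_eps_to_plane: "K_eps \<epsilon> c (to_plane z) = to_plane (\<i> * (kern \<epsilon> c z *\<^sub>R z))"
  by (simp add: K_eps_def perp_to_plane norm_to_plane kern_def flip: to_plane_scaleR)

definition velocity :: "real \<Rightarrow> real \<Rightarrow> real^3 \<Rightarrow> (3 \<Rightarrow> complex) \<Rightarrow> 3 \<Rightarrow> complex" where
  "velocity \<epsilon> c \<xi> w m =
    (\<Sum>j\<in>UNIV - {m}. \<xi> $ j *\<^sub>R (\<i> * (kern \<epsilon> c (w m - w j) *\<^sub>R (w m - w j))))"

lemma velocity_to_plane:
  "to_plane (velocity \<epsilon> c \<xi> w m) =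
    (\<Sum>j\<in>UNIV - {m}. \<xi> $ j *\<^sub>R K_eps \<epsilon> c (to_plane (w m) - to_plane (w j)))"
  by (simp add: velocity_def bounded_linear.linear[OF bounded_linear_to_plane, THEN linear_sum]
      to_plane_scaleR K_eps_to_plane flip: to_plane_diff)

text \<open>A similarity with factor \<open>z\<close> rotates the velocities along with the configuration and rescales
  them; this is why a self-similar motion reduces to a scalar equation for \<open>z\<close>.\<close>

lemma velocity_similarity:
  "velocity \<epsilon> c \<xi> (\<lambda>n. p + z * (w n - p)) m =
    z * velocity \<epsilon> c \<xi> w m / of_real (cmod z powr (3 - \<epsilon>))"
proof -
  have d: "p + z * (w m - p) - (p + z * (w n - p)) = z * (w m - w n)" for n
    by (simp add: algebra_simps)
  show ?thesis
    unfolding velocity_def d kern_mult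
    by (simp add: sum_distrib_left sum_divide_distrib scaleR_conv_of_real mult_ac)
qed

section \<open>Collapse of self-similar configurations\<close>

text \<open>The factor \<open>z\<close> is the complex power of \<open>1 - t / T\<close> with exponent \<open>- \<lambda> T\<close>: its modulus has
  exponent \<open>- T Re \<lambda> = 1 / (3 - \<epsilon>)\<close>, so \<open>z\<close> tends to zero, while a nonzero imaginary part of
  \<open>\<lambda>\<close> makes the triangle spin infinitely often on its way to the centre.\<close>

lemma self_similar_collapse:
  assumes eps: "\<epsilon> < 3"
    and inj: "inj w"
    and lam: "Re lam < 0"
    and sim: "\<And>m n. velocity \<epsilon> c \<xi> w m - velocity \<epsilon> c \<xi> w n = lam * (w m - w n)"
  shows "collapses \<epsilon> c \<xi> (\<chi> m. to_plane (w m))"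
proof -
  define p where "p = w 1 - velocity \<epsilon> c \<xi> w 1 / lam"
  define T where "T = - 1 / ((3 - \<epsilon>) * Re lam)"
  define s where "s t = 1 - t / T" for t
  define z where "z t = exp (- lam * of_real T * of_real (ln (s t)))" for t
  define x where "x t = (\<chi> m. to_plane (p + z t * (w m - p)))" for t
  have lam0: "lam \<noteq> 0" using lam by auto
  have vel: "velocity \<epsilon> c \<xi> w m = lam * (w m - p)" for m
  proof -
    have "lam * p = lam * w 1 - velocity \<epsilon> c \<xi> w 1"
      using lam0 by (simp add: p_def right_diff_distrib)
    then show ?thesis using sim[of m 1] by algebra
  qed
  have T: "T > 0" using lam eps by (simp add: T_def divide_pos_neg mult_pos_neg)
  have reT: "- (Re lam * T * r) = r / (3 - \<epsilon>)" for r using lam eps by (simp add: T_def)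
  have spos: "s t > 0" if "t < T" for t using that T by (simp add: s_def)
  have z_norm: "cmod (z t) = s t powr (1 / (3 - \<epsilon>))" if "t < T" for t
    using spos[OF that] reT by (simp add: z_def powr_def)
  have z_norm': "cmod (z t) powr (3 - \<epsilon>) = s t" if "t < T" for t
    using spos[OF that] eps by (simp add: z_norm[OF that] powr_powr)
  have z_nz: "z t \<noteq> 0" for t by (simp add: z_def)
  have z_deriv: "(z has_vector_derivative lam * z t / of_real (s t)) (at t within A)"
    if "t < T" for t A
  proof -
    have "((\<lambda>t. ln (s t)) has_real_derivative - (1 / T) / s t) (at t within A)"
      unfolding s_def using spos[OF that] T
      by (auto intro!: derivative_eq_intros simp: s_def)
    then have "((\<lambda>t. of_real (ln (s t)) :: complex) has_vector_derivative
        of_real (- (1 / T) / s t)) (at t within A)"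
      by (intro has_vector_derivative_of_real)
        (simp add: has_real_derivative_iff_has_vector_derivative)
    then have "((\<lambda>t. - lam * of_real T * of_real (ln (s t))) has_vector_derivative
        - lam * of_real T * of_real (- (1 / T) / s t)) (at t within A)"
      by (rule has_vector_derivative_mult_right)
    then have "((\<lambda>t. - lam * of_real T * of_real (ln (s t))) has_vector_derivative
        lam / of_real (s t)) (at t within A)"
      using T by (simp add: field_simps)
    from field_vector_diff_chain_within[OF this DERIV_exp[THEN has_field_derivative_at_within]]
    show ?thesis by (simp add: z_def[abs_def] o_def mult.commute)
  qed
  have sol: "vortex_solution \<epsilon> c \<xi> (\<chi> m. to_plane (w m)) T x"
    unfolding vortex_solution_def
  proof (intro conjI ballI allI impI)
    show "x 0 = (\<chi> m. to_plane (w m))"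
      by (simp add: x_def z_def s_def)
  next
    fix t i j assume "i \<noteq> (j::3)"
    then have "w i \<noteq> w j" using inj by (meson injD)
    then show "x t $ i \<noteq> x t $ j" by (simp add: x_def inj_to_plane z_nz)
  next
    fix t i assume "t \<in> {0..<T}"
    then have t: "t < T" by simp
    have "((\<lambda>t. p + z t * (w i - p)) has_vector_derivative
        lam * z t / of_real (s t) * (w i - p)) (at t within {0..<T})"
      by (auto intro!: derivative_eq_intros z_deriv t)
    also have "lam * z t / of_real (s t) * (w i - p) =
        velocity \<epsilon> c \<xi> (\<lambda>n. p + z t * (w n - p)) i"
      by (simp add: velocity_similarity z_norm'[OF t] vel)
    finally have "((\<lambda>t. p + z t * (w i - p)) has_vector_derivative
        velocity \<epsilon> c \<xi> (\<lambda>n. p + z t * (w n - p)) i) (at t within {0..<T})" .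
    from bounded_linear.has_vector_derivative[OF bounded_linear_to_plane this]
    show "((\<lambda>t. x t $ i) has_vector_derivative
        (\<Sum>j\<in>UNIV - {i}. \<xi> $ j *\<^sub>R K_eps \<epsilon> c (x t $ i - x t $ j))) (at t within {0..<T})"
      by (simp add: x_def velocity_to_plane)
  qed
  have "((\<lambda>t. s t powr (1 / (3 - \<epsilon>))) \<longlongrightarrow> 0) (at_left T)"
  proof (rule tendsto_zero_powrI)
    show "(s \<longlongrightarrow> 0) (at_left T)"
      unfolding s_def using T by (auto intro!: tendsto_eq_intros)
    show "((\<lambda>_. 1 / (3 - \<epsilon>)) \<longlongrightarrow> 1 / (3 - \<epsilon>)) (at_left T)" by simp
    show "0 < 1 / (3 - \<epsilon>)" using eps by simp
    show "\<forall>\<^sub>F t in at_left T. 0 \<le> s t"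
      using spos by (auto simp: eventually_at_filter less_imp_le)
  qed
  moreover have "\<forall>\<^sub>F t in at_left T. s t powr (1 / (3 - \<epsilon>)) = cmod (z t)"
    using z_norm by (auto simp: eventually_at_filter)
  ultimately have z0: "((\<lambda>t. cmod (z t)) \<longlongrightarrow> 0) (at_left T)"
    by (rule Lim_transform_eventually)
  have "((\<lambda>t. l (x t) i j) \<longlongrightarrow> 0) (at_left T)" for i j
  proof -
    have "l (x t) i j = cmod (z t) * cmod (w i - w j)" for t
      by (simp add: l_def x_def norm_to_plane flip: to_plane_diff right_diff_distrib norm_mult)
    then show ?thesis using tendsto_mult_left_zero[OF z0] by simp
  qed
  then show ?thesis unfolding collapses_def using T sol by blast
qed

section \<open>The two conserved quantities force self-similarity\<close>

lemma exhaust_distinct_3: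
  fixes i j k :: 3
  assumes "i \<noteq> j" "k \<noteq> i" "k \<noteq> j"
  shows "m = i \<or> m = j \<or> m = k" and "UNIV - {i} = {j, k}"
proof -
  show *: "m = i \<or> m = j \<or> m = k" for m
    using assms exhaust_3[of i] exhaust_3[of j] exhaust_3[of k] exhaust_3[of m] by metis
  show "UNIV - {i} = {j, k}" using * assms by auto
qed

text \<open>Dividing the conclusion by \<open>u v\<close> gives \<open>A + P (v / u) = B + Q (u / v)\<close>. The first relation
  between the squared lengths makes the imaginary parts agree, because \<open>v / u\<close> and \<open>u / v\<close> have
  imaginary parts of opposite sign in the ratio of \<open>(cmod v)\<^sup>2\<close> to \<open>(cmod u)\<^sup>2\<close>. With it, the real
  parts agree by the second relation, whose last factor is twice the inner product of \<open>u\<close>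
  and \<open>v\<close>. The identity also covers collinear \<open>u\<close>, \<open>v\<close>.\<close>

lemma complex_ratio_identity:
  fixes u v :: complex and A B P Q :: real
  assumes u: "u \<noteq> 0"
    and PQ: "P * (cmod v)\<^sup>2 + Q * (cmod u)\<^sup>2 = 0"
    and AB: "(A - B) * (cmod u)\<^sup>2 + P * ((cmod (u + v))\<^sup>2 - (cmod u)\<^sup>2 - (cmod v)\<^sup>2) = 0"
  shows "(A * u + P * v) * v = (B * v + Q * u) * u"
proof -
  have n: "complex_of_real ((cmod y)\<^sup>2) = y * cnj y" for y
    by (simp only: complex_norm_square)
  have 1: "P * (v * cnj v) + Q * (u * cnj u) = 0"
    using arg_cong[OF PQ, of complex_of_real] by (simp only: of_real_add of_real_mult n of_real_0)
  have 2: "(A - B) * (u * cnj u) + P * ((u + v) * cnj (u + v) - u * cnj u - v * cnj v) = 0"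
    using arg_cong[OF AB, of complex_of_real]
    by (simp only: of_real_add of_real_diff of_real_mult n of_real_0)
  have "cnj u * u * ((A * u + P * v) * v - (B * v + Q * u) * u) =
    u * v * ((A - B) * (u * cnj u) + P * ((u + v) * cnj (u + v) - u * cnj u - v * cnj v))
    - u * u * (P * (v * cnj v) + Q * (u * cnj u))"
    by (simp add: algebra_simps)
  also have "\<dots> = 0" by (simp only: 1 2) simp
  finally show ?thesis using u by simp
qed

text \<open>The proof works with the sides \<open>u\<close>, \<open>v\<close>, \<open>h\<close> of the triangle, which sum to zero, and keeps
  \<open>i\<close>, \<open>j\<close>, \<open>k\<close> generic, so that \<open>c_coeff\<close> of whichever pair is negative gives the sign of
  the real part of \<open>lam\<close> at once.\<close>

lemma collapse_of_triangle:
  fixes i j k :: 3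
  assumes ijk: "i \<noteq> j" "k \<noteq> i" "k \<noteq> j"
    and eps: "\<epsilon> < 3"
    and xi: "\<And>i. \<xi> $ i \<noteq> 0"
    and a: "\<And>i j. i \<noteq> j \<Longrightarrow> a $ i \<noteq> a $ j"
    and S: "S \<xi> a = 0" "S_eps \<epsilon> \<xi> a = 0"
    and cc: "c_coeff \<epsilon> c \<xi> a i j k < 0"
  shows "collapses \<epsilon> c \<xi> a"
proof -
  define w where "w m = Complex (a $ m $ 1) (a $ m $ 2)" for m
  have aw: "a $ m = to_plane (w m)" for m by (simp add: w_def to_plane_of_components)
  have l: "l a m n = cmod (w m - w n)" for m n
    by (simp add: l_def aw norm_to_plane flip: to_plane_diff)
  have w: "w m \<noteq> w n" if "m \<noteq> n" for m n using a[OF that] by (simp add: aw inj_to_plane)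
  define u v h where "u = w i - w j" and "v = w j - w k" and "h = w k - w i"
  define ku kv kh where "ku = kern \<epsilon> c u" and "kv = kern \<epsilon> c v" and "kh = kern \<epsilon> c h"
  have nz: "u \<noteq> 0" "v \<noteq> 0" "h \<noteq> 0" using w ijk by (auto simp: u_def v_def h_def)
  have h: "h = - (u + v)" by (simp add: u_def v_def h_def)
  have perm: "f 1 2 / \<xi> $ 3 + f 2 3 / \<xi> $ 1 + f 3 1 / \<xi> $ 2 =
      f i j / \<xi> $ k + f j k / \<xi> $ i + f k i / \<xi> $ j"
    if "\<And>m n. f m n = f n m" for f :: "3 \<Rightarrow> 3 \<Rightarrow> real"
    using ijk that[of 1 2] that[of 2 3] that[of 3 1] exhaust_3[of i] exhaust_3[of j] exhaust_3[of k]
    by auto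
  have S1: "(cmod u)\<^sup>2 / \<xi> $ k + (cmod v)\<^sup>2 / \<xi> $ i + (cmod h)\<^sup>2 / \<xi> $ j = 0"
    using S(1) perm[of "\<lambda>m n. (l a m n)\<^sup>2"]
    by (simp add: S_def l u_def v_def h_def norm_minus_commute)
  have pw: "c * cmod y powr (- 1 + \<epsilon>) = kern \<epsilon> c y * (cmod y)\<^sup>2" if "y \<noteq> 0" for y
  proof -
    have "cmod y powr (- 1 + \<epsilon>) = cmod y powr 2 / cmod y powr (3 - \<epsilon>)"
      by (simp only: powr_diff[symmetric]) simp
    then show ?thesis using that by (simp add: kern_def)
  qed
  have "c * (cmod u powr (- 1 + \<epsilon>) / \<xi> $ k + cmod v powr (- 1 + \<epsilon>) / \<xi> $ i
      + cmod h powr (- 1 + \<epsilon>) / \<xi> $ j) = 0"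
    using S(2) perm[of "\<lambda>m n. l a m n powr (- 1 + \<epsilon>)"]
    by (simp add: S_eps_def l u_def v_def h_def norm_minus_commute)
  then have S2: "ku * (cmod u)\<^sup>2 / \<xi> $ k + kv * (cmod v)\<^sup>2 / \<xi> $ i + kh * (cmod h)\<^sup>2 / \<xi> $ j = 0"
    using pw[OF nz(1)] pw[OF nz(2)] pw[OF nz(3)] by (simp add: ku_def kv_def kh_def distrib_left)
  \<comment> \<open>The velocity differences across \<open>u\<close> and \<open>v\<close> are \<open>\<i> (A u + P v)\<close> and \<open>\<i> (B v + Q u)\<close>,
    after replacing \<open>h\<close> by \<open>- (u + v)\<close>.\<close>
  define A B P Q where "A = (\<xi> $ i + \<xi> $ j) * ku + \<xi> $ k * kh"
    and "B = (\<xi> $ j + \<xi> $ k) * kv + \<xi> $ i * kh"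
    and "P = \<xi> $ k * (kh - kv)" and "Q = \<xi> $ i * (kh - ku)"
  have S1': "\<xi> $ i * \<xi> $ j * (cmod u)\<^sup>2 + \<xi> $ j * \<xi> $ k * (cmod v)\<^sup>2 + \<xi> $ i * \<xi> $ k * (cmod h)\<^sup>2 = 0"
    using S1 xi by (simp add: field_simps)
  have S2': "\<xi> $ i * \<xi> $ j * (ku * (cmod u)\<^sup>2) + \<xi> $ j * \<xi> $ k * (kv * (cmod v)\<^sup>2)
      + \<xi> $ i * \<xi> $ k * (kh * (cmod h)\<^sup>2) = 0"
    using S2 xi by (simp add: field_simps)
  \<comment> \<open>Subtracting \<open>kh\<close> times the relation \<open>S = 0\<close> from the one for \<open>S_eps\<close> eliminates \<open>h\<close>;
    subtracting \<open>kv\<close> times it eliminates \<open>v\<close>.\<close>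
  have "\<xi> $ j * (P * (cmod v)\<^sup>2 + Q * (cmod u)\<^sup>2) = 0"
    using S1' S2' unfolding P_def Q_def by algebra
  then have PQ: "P * (cmod v)\<^sup>2 + Q * (cmod u)\<^sup>2 = 0" using xi by simp
  have "\<xi> $ i * (\<xi> $ j * (ku - kv) * (cmod u)\<^sup>2 + P * (cmod h)\<^sup>2) = 0"
    using S1' S2' unfolding P_def by algebra
  then have "\<xi> $ j * (ku - kv) * (cmod u)\<^sup>2 + P * (cmod h)\<^sup>2 = 0" using xi by simp
  with PQ have AB: "(A - B) * (cmod u)\<^sup>2 + P * ((cmod (u + v))\<^sup>2 - (cmod u)\<^sup>2 - (cmod v)\<^sup>2) = 0"
    unfolding A_def B_def P_def Q_def h norm_minus_cancel by algebra
  have AP: "(A * u + P * v) * v = (B * v + Q * u) * u"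
    by (rule complex_ratio_identity[OF nz(1) PQ AB])
  define lam where "lam = \<i> * (A * u + P * v) / u"
  let ?V = "velocity \<epsilon> c \<xi> w"
  have kern': "kern \<epsilon> c (w i - w j) = ku" "kern \<epsilon> c (w j - w i) = ku"
    "kern \<epsilon> c (w j - w k) = kv" "kern \<epsilon> c (w k - w j) = kv"
    "kern \<epsilon> c (w k - w i) = kh" "kern \<epsilon> c (w i - w k) = kh"
    by (simp_all add: ku_def kv_def kh_def u_def v_def h_def kern_diff_commute)
  have U: "UNIV - {i} = {j, k}" "UNIV - {j} = {k, i}" "UNIV - {k} = {i, j}"
    using exhaust_distinct_3[of i j k] exhaust_distinct_3[of j k i] exhaust_distinct_3[of k i j] ijk
    by auto
  have V: "?V i - ?V j = lam * u" "?V j - ?V k = lam * v"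
  proof -
    have "?V i - ?V j = \<i> * (A * u + P * v)"
      using ijk by (simp add: velocity_def U kern' scaleR_conv_of_real A_def P_def u_def v_def
          algebra_simps)
    then show "?V i - ?V j = lam * u" using nz by (simp add: lam_def)
    have "?V j - ?V k = \<i> * (B * v + Q * u)"
      using ijk by (simp add: velocity_def U kern' scaleR_conv_of_real B_def Q_def u_def v_def
          algebra_simps)
    moreover have "\<i> * (B * v + Q * u) * u = \<i> * (A * u + P * v) * v"
      using AP by (simp add: mult.assoc)
    then have "\<i> * (B * v + Q * u) = lam * v"
      using nz by (simp add: lam_def eq_divide_eq)
    ultimately show "?V j - ?V k = lam * v" by simp
  qed
  have Vi: "?V m - lam * w m = ?V i - lam * w i" for m
    using exhaust_distinct_3(1)[OF ijk, of m]
  proof (elim disjE)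
    assume "m = j"
    show ?thesis using V(1) unfolding u_def \<open>m = j\<close> by algebra
  next
    assume "m = k"
    show ?thesis using V unfolding u_def v_def \<open>m = k\<close> by algebra
  qed simp
  have sim: "?V m - ?V n = lam * (w m - w n)" for m n
    using Vi[of m] Vi[of n] by algebra
  \<comment> \<open>The side lengths at the vertex \<open>k\<close> and the sine combine into twice the signed area of the
    triangle, which is what the real part of \<open>lam\<close> contains as well.\<close>
  have "c_coeff \<epsilon> c \<xi> a i j k = l a i j powr (1 - \<epsilon>) * (P *
      (norm (a $ j - a $ k) * norm (a $ i - a $ k) * sin (angle a i j k)))"
  proof -
    have "norm (a $ j - a $ k) = l a k j" "norm (a $ i - a $ k) = l a i k"
      by (simp_all add: l_def norm_minus_commute)
    moreover have "kh = c / l a i k powr (3 - \<epsilon>)" "kv = c / l a k j powr (3 - \<epsilon>)"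
      by (simp_all add: kh_def kv_def kern_def h_def v_def l norm_minus_commute)
    ultimately show ?thesis
      unfolding c_coeff_def P_def by (simp add: algebra_simps)
  qed
  also have "norm (a $ j - a $ k) * norm (a $ i - a $ k) * sin (angle a i j k) =
      Im (cnj v * (- h))"
  proof -
    have "a $ j - a $ k \<noteq> 0" "a $ i - a $ k \<noteq> 0" using a ijk by auto
    then show ?thesis
      unfolding angle_def by (subst cos_sin_oriented_angle(2))
        (simp_all add: aw perp_inner_to_plane v_def h_def flip: to_plane_diff)
  qed
  also have "P * Im (cnj v * (- h)) = (cmod u)\<^sup>2 * Re lam"
  proof -
    have "lam * (u * cnj u) = \<i> * (A * u + P * v) * cnj u" using nz by (simp add: lam_def)
    then have "lam * complex_of_real ((cmod u)\<^sup>2) = \<i> * (A * u + P * v) * cnj u"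
      by (simp only: complex_norm_square)
    from arg_cong[OF this, of Re] show ?thesis
      by (simp add: h algebra_simps)
  qed
  finally have "Re lam < 0"
    using cc by (smt (verit) mult_nonneg_nonneg powr_ge_zero zero_le_power2)
  moreover have "inj w" using w by (meson injI)
  ultimately have "collapses \<epsilon> c \<xi> (\<chi> m. to_plane (w m))"
    using self_similar_collapse[OF eps _ _ sim] by blast
  also have "(\<chi> m. to_plane (w m)) = a" by (simp add: vec_eq_iff aw)
  finally show ?thesis .
qed

section \<open>An explicit configuration\<close>

lemma power_bounds:
  fixes x q :: real
  assumes "0 < x" "x ^ n = q" "0 \<le> lo" "0 \<le> hi" "lo ^ n < q" "q < hi ^ n"
  shows "lo < x" "x < hi"
proof -
  show "lo < x" using assms by (intro power_less_imp_less_base[of lo n x]) simp_all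
  show "x < hi" using assms by (intro power_less_imp_less_base[of x n hi]) simp_all
qed

lemma powr_quarter_power: "0 < x \<Longrightarrow> (x powr (- 1 / 4)) ^ 4 = 1 / (x::real)"
  using powr_power[of x "- 1 / 4" 4] by (simp add: powr_minus_divide)

text \<open>Cramer's rule for the reciprocals gives \<open>1 / y1 = d / n\<close> and \<open>1 / y3 = - (3 n + d) / (2 n)\<close>.
  The numerical claims become inequalities that are linear in \<open>s\<close>, \<open>s\<^sup>2\<close> and \<open>t\<close> once the positive
  denominators are cleared, so bounding \<open>s\<^sup>2\<close> separately avoids nonlinear estimates.\<close>

lemma explicit_intensities:
  fixes s t :: real
  defines "s \<equiv> 2 powr (- 1 / 4)" and "t \<equiv> 6 powr (- 1 / 4)"
  defines "n \<equiv> s - s\<^sup>2 / 2" and "d \<equiv> 3 / 2 * s\<^sup>2 - t"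
  shows "y1 \<noteq> 0 \<and> y3 \<noteq> 0 \<and> 4 / y3 + 2 / y1 + 6 = 0 \<and>
      2 powr (- 1 / 2) / y3 + 2 powr (- 1 / 4) / y1 + 6 powr (- 1 / 4) = 0
    \<longleftrightarrow> y1 = n / d \<and> y3 = - 2 * n / (3 * n + d)"
    and "\<bar>n / d - 1.155616\<bar> < 5 / 10 ^ 7"
    and "\<bar>- 2 * n / (3 * n + d) - (- 0.517419)\<bar> < 5 / 10 ^ 7"
proof -
  have s: "0.8408964152 < s" "s < 0.8408964153"
    using power_bounds[of s 4 "1/2" "0.8408964152" "0.8408964153"] powr_quarter_power[of 2]
    by (simp_all add: s_def power_divide)
  have "(s\<^sup>2)\<^sup>2 = 1 / 2" using powr_quarter_power[of 2] by (simp add: s_def)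
  then have s2: "0.7071067811 < s\<^sup>2" "s\<^sup>2 < 0.7071067812"
    using power_bounds[of "s\<^sup>2" 2 "1/2" "0.7071067811" "0.7071067812"] s
    by (simp_all add: power_divide)
  have t: "0.6389431042 < t" "t < 0.6389431043"
    using power_bounds[of t 4 "1/6" "0.6389431042" "0.6389431043"] powr_quarter_power[of 6]
    by (simp_all add: t_def power_divide)
  have n: "n > 0" and d: "d > 0" using s s2 t by (simp_all add: n_def d_def)
  show "\<bar>n / d - 1.155616\<bar> < 5 / 10 ^ 7"
    using s s2 t d unfolding abs_less_iff by (simp add: field_simps) (simp add: n_def d_def)
  show "\<bar>- 2 * n / (3 * n + d) - (- 0.517419)\<bar> < 5 / 10 ^ 7"
    using s s2 t n d unfolding abs_less_iff
    by (simp add: field_simps add_pos_pos) (simp add: n_def d_def)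
  have half: "2 powr (- 1 / 2) = s\<^sup>2"
    by (simp add: s_def power2_eq_square powr_add[symmetric])
  have lin: "4 * q + 2 * p + 6 = 0 \<and> s\<^sup>2 * q + s * p + t = 0 \<longleftrightarrow>
      p = d / n \<and> q = - (3 * n + d) / (2 * n)" for p q
  proof -
    have "s\<^sup>2 * (- (3 + p) / 2) + s * p + t = n * p - d"
      by (simp add: n_def d_def field_simps)
    moreover have "4 * q + 2 * p + 6 = 0 \<longleftrightarrow> q = - (3 + p) / 2" by auto
    ultimately have "4 * q + 2 * p + 6 = 0 \<and> s\<^sup>2 * q + s * p + t = 0 \<longleftrightarrow>
      n * p = d \<and> q = - (3 + p) / 2" by (metis eq_iff_diff_eq_0)
    also have "\<dots> \<longleftrightarrow> p = d / n \<and> q = - (3 * n + d) / (2 * n)"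
    proof -
      have "n * p = d \<longleftrightarrow> p = d / n" using n by (auto simp: field_simps)
      moreover have "- (3 + d / n) / 2 = - (3 * n + d) / (2 * n)" using n by (simp add: field_simps)
      ultimately show ?thesis by metis
    qed
    finally show ?thesis .
  qed
  have "y1 \<noteq> 0 \<and> y3 \<noteq> 0 \<and> 4 / y3 + 2 / y1 + 6 = 0 \<and> s\<^sup>2 / y3 + s / y1 + t = 0 \<longleftrightarrow>
      y1 \<noteq> 0 \<and> y3 \<noteq> 0 \<and> 1 / y1 = d / n \<and> 1 / y3 = - (3 * n + d) / (2 * n)"
    using lin[of "1 / y3" "1 / y1"] by simp
  also have "\<dots> \<longleftrightarrow> y1 = n / d \<and> y3 = - 2 * n / (3 * n + d)"
  proof -
    have recip: "y \<noteq> 0 \<and> 1 / y = e / f \<longleftrightarrow> y = f / e" if "e \<noteq> 0" "f \<noteq> 0" for y e f :: real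
      using that by (auto simp: field_simps)
    define e where "e = 3 * n + d"
    have "e > 0" using n d by (simp add: e_def)
    then show ?thesis
      unfolding e_def[symmetric] using n d recip[of d n y1] recip[of "- e" "2 * n" y3] by auto
  qed
  finally show "y1 \<noteq> 0 \<and> y3 \<noteq> 0 \<and> 4 / y3 + 2 / y1 + 6 = 0 \<and>
      2 powr (- 1 / 2) / y3 + 2 powr (- 1 / 4) / y1 + 6 powr (- 1 / 4) = 0
    \<longleftrightarrow> y1 = n / d \<and> y3 = - 2 * n / (3 * n + d)"
    unfolding half s_def[symmetric] t_def[symmetric] .
qed

lemma explicit_collapse:
  fixes \<xi>1 \<xi>3 :: real
  assumes xi: "\<xi>1 \<noteq> 0" "\<xi>3 < 0" and c: "c > 0"
    and S: "4 / \<xi>3 + 2 / \<xi>1 + 6 = 0"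
    and S_eps: "2 powr (- 1 / 2) / \<xi>3 + 2 powr (- 1 / 4) / \<xi>1 + 6 powr (- 1 / 4) = 0"
  shows "collapses (1 / 2) c (vector [\<xi>1, 1, \<xi>3])
    (vector [vector [- 1, 0], vector [1, 0], vector [1, sqrt 2]])"
proof -
  let ?a = "vector [vector [- 1, 0], vector [1, 0], vector [1, sqrt 2]] :: (real^2)^3"
  let ?\<xi> = "vector [\<xi>1, 1, \<xi>3] :: real^3"
  have l: "l ?a 1 2 = 2" "l ?a 2 3 = sqrt 2" "l ?a 3 1 = sqrt 6" "l ?a 1 3 = sqrt 6" "l ?a 3 2 = sqrt 2"
    by (simp_all add: l_def norm_vec_def L2_set_def sum_2)
  have sq: "sqrt x powr - (1 / 2) = x powr - (1 / 4)" if "x > 0" for x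
    using that by (simp add: powr_half_sqrt[symmetric] powr_powr)
  show ?thesis
  proof (rule collapse_of_triangle[of 1 2 3])
    show "?a $ i \<noteq> ?a $ j" if "i \<noteq> j" for i j
      using that exhaust_3[of i] exhaust_3[of j] by (auto simp: vec_eq_iff forall_2)
    show "?\<xi> $ i \<noteq> 0" for i
      using xi exhaust_3[of i] by auto
    show "S ?\<xi> ?a = 0" using S by (simp add: S_def l)
    show "S_eps (1 / 2) ?\<xi> ?a = 0" using S_eps by (simp add: S_eps_def l sq)
    have "sin (angle ?a 1 2 3) < 0"
    proof -
      let ?u = "?a $ 2 - ?a $ 3" and ?v = "?a $ 1 - ?a $ 3"
      have nz: "?u \<noteq> 0" "?v \<noteq> 0" by (auto simp: vec_eq_iff forall_2)
      have "norm ?u * norm ?v * sin (angle ?a 1 2 3) = - (2 * sqrt 2)"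
        unfolding angle_def cos_sin_oriented_angle(2)[OF nz]
        by (simp add: perp_def inner_vec_def sum_2)
      moreover have "norm ?u * norm ?v > 0" using nz by simp
      ultimately show ?thesis
        by (smt (verit) mult_nonneg_nonneg real_sqrt_gt_zero)
    qed
    moreover have "1 / sqrt 6 powr (5 / 2) - 1 / sqrt 2 powr (5 / 2) < 0"
      by (simp add: frac_less2 powr_less_mono2)
    ultimately show "c_coeff (1 / 2) c ?\<xi> ?a 1 2 3 < 0"
      using xi c by (simp add: c_coeff_def l mult_less_0_iff zero_less_mult_iff)
  qed simp_all
qed

theorem mainTheorem2:
  "(\<forall>\<epsilon> c \<xi> a.
      0 < \<epsilon> \<and> \<epsilon> < 1 \<and> 0 < c \<and> (\<forall>i. \<xi> $ i \<noteq> 0) \<and> (\<forall>i j. i \<noteq> j \<longrightarrow> a $ i \<noteq> a $ j) \<and>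
      S \<xi> a = 0 \<and> S_eps \<epsilon> \<xi> a = 0 \<and>
      (\<exists>i j k. i \<noteq> j \<and> k \<noteq> i \<and> k \<noteq> j \<and> c_coeff \<epsilon> c \<xi> a i j k < 0)
      \<longrightarrow> collapses \<epsilon> c \<xi> a)
   \<and>
   (\<exists>\<xi>1 \<xi>3 :: real.
      (\<forall>y1 y3. (y1 \<noteq> 0 \<and> y3 \<noteq> 0 \<and> 4 / y3 + 2 / y1 + 6 = 0 \<and>
          2 powr (- 1 / 2) / y3 + 2 powr (- 1 / 4) / y1 + 6 powr (- 1 / 4) = 0)
        \<longleftrightarrow> y1 = \<xi>1 \<and> y3 = \<xi>3) \<and>
      \<bar>\<xi>1 - 1.155616\<bar> < 5 / 10 ^ 7 \<and> \<bar>\<xi>3 - (- 0.517419)\<bar> < 5 / 10 ^ 7 \<and>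
      (\<forall>c>0. collapses (1 / 2) c (vector [\<xi>1, 1, \<xi>3])
        (vector [vector [- 1, 0], vector [1, 0], vector [1, sqrt 2]])))"
proof -
  have general: "collapses \<epsilon> c \<xi> a"
    if "0 < \<epsilon> \<and> \<epsilon> < 1 \<and> 0 < c \<and> (\<forall>i. \<xi> $ i \<noteq> 0) \<and> (\<forall>i j. i \<noteq> j \<longrightarrow> a $ i \<noteq> a $ j) \<and>
      S \<xi> a = 0 \<and> S_eps \<epsilon> \<xi> a = 0 \<and>
      (\<exists>i j k. i \<noteq> j \<and> k \<noteq> i \<and> k \<noteq> j \<and> c_coeff \<epsilon> c \<xi> a i j k < 0)" for \<epsilon> c \<xi> a
  proof -
    from that obtain i j k where ijk: "i \<noteq> j" "k \<noteq> i" "k \<noteq> j" "c_coeff \<epsilon> c \<xi> a i j k < 0" by blast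
    show ?thesis by (rule collapse_of_triangle[OF ijk(1-3) _ _ _ _ _ ijk(4)]) (use that in auto)
  qed
  obtain \<xi>1 \<xi>3 :: real where
    sol: "\<And>y1 y3. (y1 \<noteq> 0 \<and> y3 \<noteq> 0 \<and> 4 / y3 + 2 / y1 + 6 = 0 \<and>
        2 powr (- 1 / 2) / y3 + 2 powr (- 1 / 4) / y1 + 6 powr (- 1 / 4) = 0)
      \<longleftrightarrow> y1 = \<xi>1 \<and> y3 = \<xi>3"
    and num: "\<bar>\<xi>1 - 1.155616\<bar> < 5 / 10 ^ 7" "\<bar>\<xi>3 - (- 0.517419)\<bar> < 5 / 10 ^ 7"
    using explicit_intensities by blast
  have neg: "\<xi>3 < 0" using num(2) unfolding abs_less_iff by simp
  have "collapses (1 / 2) c (vector [\<xi>1, 1, \<xi>3])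
      (vector [vector [- 1, 0], vector [1, 0], vector [1, sqrt 2]])" if "c > 0" for c
    using sol[of \<xi>1 \<xi>3] neg that by (intro explicit_collapse) auto
  with general sol num show ?thesis by blast
qed

end
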